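(* Let $d \geq 4$ be an integer and let $n$ be a sufficiently large integer. If $q$ is a positive integer with $q \leq n/(1000 d)$, then, playing the $(q:1)$ Waiter-Client game on $E(K_n)$, Waiter has a strategy to ensure that after at most $200 n d$ rounds, Client's graph $G_C$ satisfies all of the following properties: (i) $G_C$ is a $(d/2-1, 1/(20d))$-expander; (ii) $G_C$ contains a cycle of length $k$ for every $3 \leq k \leq \lceil n/6 \rceil$; (iii) $G_C$ is connected.
   Context: The $(q:1)$ Waiter-Client game on $E(K_n)$ (for a positive integer $q$) is the following two-player perfect information game. In each round, Waiter offers Client exactly $q+1$ edges of the complete graph $K_n$ which have not been claimed before; Client chooses one of these edges, which he keeps, and the remaining $q$ edges are claimed by Waiter. If fewer than $q+1$ unclaimed edges remain, all of them are claimed by Waiter. The game ends when all edges of $K_n$ have been claimed. At any point of the game, Client's graph $G_C$ is the graph with vertex set $V(K_n)$ whose edges are all the edges claimed so far by Client. For a graph $G$ and $S \subseteq V(G)$, $N_G(S) = \{v \in V(G) \setminus S : \exists u \in S \text{ such that } uv \in E(G)\}$. For real numbers $d' \geq 1$ and $0 < \varepsilon < 1$, a graph $G$ is called a $(d',\varepsilon)$-expander if $|N_G(S)| \geq d'|S|$ holds for every $S \subseteq V(G)$ with $|S| \leq \varepsilon |V(G)|$. *)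

theory Defs
  imports Complex_Main "HOL-Library.Ramsey"
begin

text \<open>A graph is given by a vertex set \<open>V\<close> and an edge set \<open>E \<subseteq> nsets V 2\<close> of two-element
  subsets of \<open>V\<close>; the complete graph on \<open>V\<close> has edge set \<open>nsets V 2\<close>.\<close>

definition neighbourhood :: "'a set \<Rightarrow> 'a set set \<Rightarrow> 'a set \<Rightarrow> 'a set" where
  "neighbourhood V E S = {v \<in> V - S. \<exists>u\<in>S. {u, v} \<in> E}"

definition expander :: "'a set \<Rightarrow> 'a set set \<Rightarrow> real \<Rightarrow> real \<Rightarrow> bool" where
  "expander V E d' \<epsilon> \<longleftrightarrow>
     (\<forall>S \<subseteq> V. real (card S) \<le> \<epsilon> * real (card V) \<longrightarrow>
        real (card (neighbourhood V E S)) \<ge> d' * real (card S))"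

definition has_cycle :: "'a set \<Rightarrow> 'a set set \<Rightarrow> nat \<Rightarrow> bool" where
  "has_cycle V E k \<longleftrightarrow> k \<ge> 3 \<and>
     (\<exists>xs. length xs = k \<and> distinct xs \<and> set xs \<subseteq> V \<and>
        (\<forall>i<k. {xs ! i, xs ! (Suc i mod k)} \<in> E))"

definition graph_connected :: "'a set \<Rightarrow> 'a set set \<Rightarrow> bool" where
  "graph_connected V E \<longleftrightarrow> V \<noteq> {} \<and>
     (\<forall>u\<in>V. \<forall>v\<in>V. (u, v) \<in> {(x, y). x \<in> V \<and> y \<in> V \<and> {x, y} \<in> E}\<^sup>*)"

text \<open>A position of the game on a board \<open>X\<close> is a pair \<open>(C, W)\<close> of the elements claimed so far by
  Client and by Waiter.\<close>

type_synonym 'e position = "'e set \<times> 'e set"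

definition unclaimed :: "'e set \<Rightarrow> 'e position \<Rightarrow> 'e set" where
  "unclaimed X p = X - (fst p \<union> snd p)"

text \<open>A history is the nonempty list of the positions reached so far, so that entry \<open>t\<close> is the
  position after \<open>t\<close> rounds. It determines all earlier offers and choices.
  A strategy of Waiter assigns to each history the set he offers next. Its values at histories
  that cannot arise, or where at most \<open>q\<close> elements are unclaimed, are irrelevant.\<close>

type_synonym 'e waiter_strategy = "'e position list \<Rightarrow> 'e set"

inductive wc_play :: "'e set \<Rightarrow> nat \<Rightarrow> 'e waiter_strategy \<Rightarrow> 'e position list \<Rightarrow> bool"
  for X :: "'e set" and q :: nat and \<sigma> :: "'e waiter_strategy" where
  start: "wc_play X q \<sigma> [({}, {})]"
| offer: "\<lbrakk>wc_play X q \<sigma> ps; last ps = (C, W); card (unclaimed X (C, W)) \<ge> q + 1; e \<in> \<sigma> ps\<rbrakk>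
    \<Longrightarrow> wc_play X q \<sigma> (ps @ [(insert e C, W \<union> (\<sigma> ps - {e}))])"
| leftover: "\<lbrakk>wc_play X q \<sigma> ps; last ps = (C, W);
      unclaimed X (C, W) \<noteq> {}; card (unclaimed X (C, W)) < q + 1\<rbrakk>
    \<Longrightarrow> wc_play X q \<sigma> (ps @ [(C, W \<union> unclaimed X (C, W))])"

definition legal_waiter_strategy :: "'e set \<Rightarrow> nat \<Rightarrow> 'e waiter_strategy \<Rightarrow> bool" where
  "legal_waiter_strategy X q \<sigma> \<longleftrightarrow>
     (\<forall>ps. wc_play X q \<sigma> ps \<and> card (unclaimed X (last ps)) \<ge> q + 1 \<longrightarrow>
        \<sigma> ps \<subseteq> unclaimed X (last ps) \<and> card (\<sigma> ps) = q + 1)"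

text \<open>In every play that Waiter conducts to the end according to some legal strategy, Client's set
  has property \<open>P\<close> after \<open>t\<close> rounds for some \<open>t \<le> T\<close>; this \<open>t\<close> may depend on Client's choices.\<close>

definition waiter_can_ensure_within ::
    "'e set \<Rightarrow> nat \<Rightarrow> nat \<Rightarrow> ('e set \<Rightarrow> bool) \<Rightarrow> bool" where
  "waiter_can_ensure_within X q T P \<longleftrightarrow>
     (\<exists>\<sigma>. legal_waiter_strategy X q \<sigma> \<and>
        (\<forall>ps. wc_play X q \<sigma> ps \<and> unclaimed X (last ps) = {} \<longrightarrow>
           (\<exists>t < length ps. t \<le> T \<and> P (fst (ps ! t)))))"

end

theory Submission
  imports Defs
begin

text \<open>Split the vertices into thirds \<open>V\<^sub>1\<close>, \<open>V\<^sub>2\<close>, \<open>V\<^sub>3\<close>. Inside \<open>V\<^sub>1\<close> Waiter first forces a path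
  \<open>v\<^sub>0 v\<^sub>1 \<dots>\<close> of length about \<open>n/6\<close> by always offering edges from its end to new vertices, then a
  tooth \<open>b\<^sub>h\<close> at each \<open>v\<^sub>h\<close> with \<open>h \<le> q\<close>. For each \<open>k\<close> he offers the \<open>q + 1\<close> edges joining \<open>b\<^sub>h\<close> to
  the path vertex with index \<open>h + k - 2\<close>; whichever Client takes closes a cycle of length \<open>k\<close>.
  Afterwards every vertex makes \<open>3d\<close> offers, from \<open>V\<^sub>1\<close> into \<open>V\<^sub>2\<close>, from \<open>V\<^sub>2\<close> into \<open>V\<^sub>3\<close> and from \<open>V\<^sub>3\<close>
  to the path, which already makes the graph connected. Since \<open>q\<close> is small compared with \<open>n\<close>,
  offering the \<open>q + 1\<close> least dangerous edges is nearly as good as letting chance choose, and a union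
  bound over the sets \<open>S\<close> and their supposed small neighbourhoods gives the expansion.\<close>

section \<open>Forcing a position\<close>

text \<open>\<open>C\<close> is Client's set, \<open>U\<close> the set of unclaimed elements, and \<open>k\<close> the exact number of rounds.\<close>

primrec forces :: "nat \<Rightarrow> nat \<Rightarrow> ('e set \<Rightarrow> 'e set \<Rightarrow> bool) \<Rightarrow> 'e set \<Rightarrow> 'e set \<Rightarrow> bool" where
  "forces q 0 P C U \<longleftrightarrow> P C U"
| "forces q (Suc k) P C U \<longleftrightarrow>
     (\<exists>A \<subseteq> U. card A = q + 1 \<and> (\<forall>e\<in>A. forces q k P (insert e C) (U - A)))"

lemma forces_mono:
  assumes "forces q k P C U" "\<And>C U. P C U \<Longrightarrow> Q C U"
  shows "forces q k Q C U"
  using assms(1)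
proof (induction k arbitrary: C U)
  case 0
  then show ?case using assms(2) by simp
next
  case (Suc k)
  then show ?case by (meson forces.simps(2))
qed

lemma forces_trans:
  assumes "forces q k P C U" "\<And>C U. P C U \<Longrightarrow> forces q l Q C U"
  shows "forces q (k + l) Q C U"
  using assms(1)
proof (induction k arbitrary: C U)
  case 0
  then show ?case using assms(2) by simp
next
  case (Suc k)
  then show ?case by (metis add_Suc forces.simps(2))
qed

lemma forces_iterate:
  assumes "I 0 C U" "\<And>i C U. i < m \<Longrightarrow> I i C U \<Longrightarrow> forces q 1 (I (Suc i)) C U"
  shows "forces q m (I m) C U"
  using assms(2)
proof (induction m)
  case 0
  then show ?case using assms(1) by simp
next
  case (Suc m)
  have "forces q (m + 1) (I (Suc m)) C U"
    by (rule forces_trans[where P = "I m"]) (use Suc in auto)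
  then show ?case by simp
qed

text \<open>Client only gains edges, and only unclaimed ones. Paths and cycles of one stage
  therefore survive the later ones, and no edge outside the current board becomes Client's.\<close>

lemma forces_invariant:
  assumes "forces q k P C U"
  shows "forces q k (\<lambda>C' U'. P C' U' \<and> C \<subseteq> C' \<and> C' \<subseteq> C \<union> U) C U"
  using assms
proof (induction k arbitrary: C U)
  case 0
  then show ?case by simp
next
  case (Suc k)
  then obtain A where A: "A \<subseteq> U" "card A = q + 1"
    "\<And>e. e \<in> A \<Longrightarrow> forces q k P (insert e C) (U - A)"
    by auto
  have "forces q k (\<lambda>C' U'. P C' U' \<and> C \<subseteq> C' \<and> C' \<subseteq> C \<union> U) (insert e C) (U - A)" if "e \<in> A" for e
    by (rule forces_mono[OF Suc.IH[OF A(3)[OF that]]]) (use A(1) that in auto)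
  then show ?case using A by auto
qed

text \<open>Every offer is a subset of \<open>U\<close>, so a strategy for a smaller board also
  works on a larger one and leaves the extra edges \<open>R\<close> free for later stages.\<close>

lemma forces_frame:
  assumes "forces q k P C U" "U \<inter> R = {}"
  shows "forces q k (\<lambda>C' V'. \<exists>U'. V' = U' \<union> R \<and> P C' U') C (U \<union> R)"
  using assms
proof (induction k arbitrary: C U)
  case 0
  then show ?case by auto
next
  case (Suc k)
  then obtain A where A: "A \<subseteq> U" "card A = q + 1"
    "\<And>e. e \<in> A \<Longrightarrow> forces q k P (insert e C) (U - A)"
    by auto
  have eq: "U \<union> R - A = (U - A) \<union> R"
    using A(1) Suc.prems(2) by auto
  have "forces q k (\<lambda>C' V'. \<exists>U'. V' = U' \<union> R \<and> P C' U') (insert e C) (U \<union> R - A)" if "e \<in> A" for e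
    unfolding eq by (rule Suc.IH[OF A(3)[OF that]]) (use Suc.prems(2) in auto)
  then show ?case using A by auto
qed

section \<open>From forced positions to legal strategies\<close>

lemma wc_play_take:
  assumes "wc_play X q \<sigma> ps" "0 < j" "j \<le> length ps"
  shows "wc_play X q \<sigma> (take j ps)"
  using assms
proof (induction rule: wc_play.induct)
  case start
  then show ?case by (auto simp: wc_play.start)
next
  case (offer ps C W e)
  show ?case
  proof (cases "j \<le> length ps")
    case True
    then show ?thesis using offer by simp
  next
    case False
    then show ?thesis using offer wc_play.offer[OF offer(1-4)] by simp
  qed
next
  case (leftover ps C W)
  show ?case
  proof (cases "j \<le> length ps")
    case True
    then show ?thesis using leftover by simp
  next
    case False
    then show ?thesis using leftover wc_play.leftover[OF leftover(1-4)] by simp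
  qed
qed

lemma waiter_can_ensure_withinI:
  assumes fin: "finite X" and f: "forces q k (\<lambda>C U. P C) {} X" and "k \<le> T"
  shows "waiter_can_ensure_within X q T P"
proof -
  \<comment> \<open>A history of length \<open>l\<close> has seen \<open>l - 1\<close> rounds. So
    \<open>length ps \<le> k\<close> means that fewer than \<open>k\<close> rounds are over and the
    offer must keep \<open>P\<close> forced; afterwards any legal offer is good.\<close>
  define good where "good ps A \<longleftrightarrow> A \<subseteq> unclaimed X (last ps) \<and> card A = q + 1 \<and>
    (length ps \<le> k \<longrightarrow> (\<forall>e\<in>A. forces q (k - length ps) (\<lambda>C U. P C)
        (insert e (fst (last ps))) (unclaimed X (last ps) - A)))" for ps A
  define \<sigma> where "\<sigma> ps = (SOME A. good ps A)" for ps
  have good: "good ps (\<sigma> ps)"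
    if "length ps \<le> k \<Longrightarrow>
         forces q (Suc (k - length ps)) (\<lambda>C U. P C) (fst (last ps)) (unclaimed X (last ps))"
      and card: "card (unclaimed X (last ps)) \<ge> q + 1" for ps
  proof (cases "length ps \<le> k")
    case True
    then have "\<exists>A. good ps A" using that(1) by (auto simp: good_def)
    then show ?thesis unfolding \<sigma>_def by (rule someI_ex)
  next
    case False
    obtain A where "A \<subseteq> unclaimed X (last ps)" "card A = q + 1"
      using card obtain_subset_with_card_n by metis
    then have "\<exists>A. good ps A" using False by (auto simp: good_def)
    then show ?thesis unfolding \<sigma>_def by (rule someI_ex)
  qed
  have finu: "finite (unclaimed X p)" for p
    using fin by (simp add: unclaimed_def)
  \<comment> \<open>\<open>Suc k - length ps\<close> is the number of forced rounds still to
    come.\<close>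
  have inv: "forces q (Suc k - length ps) (\<lambda>C U. P C) (fst (last ps)) (unclaimed X (last ps))"
    if "wc_play X q \<sigma> ps" "length ps \<le> Suc k" for ps
    using that
  proof (induction rule: wc_play.induct)
    case start
    then show ?case using f by (simp add: unclaimed_def)
  next
    case (offer ps C W e)
    then have len: "length ps \<le> k" by simp
    have "good ps (\<sigma> ps)"
      using offer.IH offer.hyps len by (intro good) (auto simp: Suc_diff_le)
    moreover have "unclaimed X (insert e C, W \<union> (\<sigma> ps - {e})) = unclaimed X (last ps) - \<sigma> ps"
      using offer.hyps by (auto simp: unclaimed_def)
    ultimately show ?case using offer.hyps len by (simp add: good_def)
  next
    case (leftover ps C W)
    then have "forces q (Suc (k - length ps)) (\<lambda>C U. P C) C (unclaimed X (C, W))"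
      by (simp add: Suc_diff_le)
    \<comment> \<open>A forced round offers \<open>q + 1\<close> unclaimed edges, so a leftover
      round cannot occur among the first \<open>k\<close>.\<close>
    then obtain A where "A \<subseteq> unclaimed X (C, W)" "card A = q + 1"
      by auto
    then show ?case using leftover.hyps card_mono[OF finu] by (metis not_le)
  qed
  have "legal_waiter_strategy X q \<sigma>"
    unfolding legal_waiter_strategy_def
  proof (intro allI impI, elim conjE)
    fix ps assume ps: "wc_play X q \<sigma> ps" "card (unclaimed X (last ps)) \<ge> q + 1"
    have "good ps (\<sigma> ps)"
      using inv[OF ps(1)] ps(2) by (intro good) (auto simp: Suc_diff_le)
    then show "\<sigma> ps \<subseteq> unclaimed X (last ps) \<and> card (\<sigma> ps) = q + 1"
      by (simp add: good_def)
  qed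
  moreover have "\<exists>t < length ps. t \<le> T \<and> P (fst (ps ! t))"
    if ps: "wc_play X q \<sigma> ps" "unclaimed X (last ps) = {}" for ps
  proof -
    have len: "k < length ps"
    proof (rule ccontr)
      assume "\<not> k < length ps"
      then have "length ps \<le> k" by simp
      then have "forces q (Suc (k - length ps)) (\<lambda>C U. P C) (fst (last ps)) {}"
        using inv[OF ps(1)] ps(2) by (simp add: Suc_diff_le)
      then show False by auto
    qed
    then have "wc_play X q \<sigma> (take (Suc k) ps)"
      by (intro wc_play_take ps) auto
    from inv[OF this] len have "P (fst (last (take (Suc k) ps)))"
      by (simp add: min_def)
    moreover have "last (take (Suc k) ps) = ps ! k"
      using len by (simp add: take_Suc_conv_app_nth)
    ultimately show ?thesis using len \<open>k \<le> T\<close> by auto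
  qed
  ultimately show ?thesis
    unfolding waiter_can_ensure_within_def by blast
qed

lemma inj_on_doubleton: "inj_on (\<lambda>y. {v, y}) Y"
  by (auto simp: inj_on_def doubleton_eq_iff)

text \<open>Template for all moves except those closing cycles: the offered edges share the end
  \<open>v\<close>. \<open>P\<close> is demanded for every \<open>Z\<close>, so it does not matter
  which candidates in \<open>Y\<close> are offered.\<close>

lemma forces_star:
  assumes "card Y \<ge> q + 1" "\<And>y. y \<in> Y \<Longrightarrow> {v, y} \<in> U"
    and "\<And>Z y. Z \<subseteq> Y \<Longrightarrow> card Z = q + 1 \<Longrightarrow> y \<in> Z \<Longrightarrow>
           P (insert {v, y} C) (U - (\<lambda>y. {v, y}) ` Z)"
  shows "forces q 1 P C U"
proof -
  obtain Z where Z: "Z \<subseteq> Y" "card Z = q + 1"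
    using assms(1) obtain_subset_with_card_n by metis
  have "card ((\<lambda>y. {v, y}) ` Z) = q + 1"
    using Z by (simp add: card_image inj_on_doubleton)
  then show ?thesis
    using Z assms(2,3) by (auto intro!: exI[of _ "(\<lambda>y. {v, y}) ` Z"])
qed

section \<open>Cycles of all lengths\<close>

lemma forces_path:
  assumes A: "finite A" "card A \<ge> q + 1 + l" and U: "nsets A 2 \<subseteq> U"
  shows "forces q l (\<lambda>C' U'. \<exists>xs. length xs = Suc l \<and> distinct xs \<and> set xs \<subseteq> A \<and>
           successively (\<lambda>u v. {u, v} \<in> C') xs) C U"
proof -
  \<comment> \<open>The path grows at its head. Each offer consists of edges at the current head,
    which is an inner vertex from then on, so edges among unvisited vertices and from the new head
    to them stay unclaimed.\<close>
  define I where "I i C' U' \<longleftrightarrow> (\<exists>xs. length xs = Suc i \<and> distinct xs \<and> set xs \<subseteq> A \<and>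
    successively (\<lambda>u v. {u, v} \<in> C') xs \<and>
    (\<forall>y \<in> A - set xs. \<forall>z \<in> insert (hd xs) (A - set xs). y \<noteq> z \<longrightarrow> {z, y} \<in> U'))"
    for i C' U'
  obtain a where "a \<in> A" using A by (metis all_not_in_conv card.empty add_is_0 le_zero_eq one_neq_zero)
  have "I 0 C U"
    unfolding I_def
    using \<open>a \<in> A\<close> U by (intro exI[of _ "[a]"]) (auto simp: nsets_def card_insert_if)
  moreover have "forces q 1 (I (Suc i)) C U" if "i < l" "I i C U" for i C U
  proof -
    obtain xs where xs: "length xs = Suc i" "distinct xs" "set xs \<subseteq> A"
      "successively (\<lambda>u v. {u, v} \<in> C) xs"
      "\<And>y z. y \<in> A - set xs \<Longrightarrow> z \<in> insert (hd xs) (A - set xs) \<Longrightarrow> y \<noteq> z \<Longrightarrow> {z, y} \<in> U"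
      using \<open>I i C U\<close> unfolding I_def by blast
    have "xs \<noteq> []" using xs(1) by auto
    then have hd: "hd xs \<in> set xs" by simp
    have "card (A - set xs) = card A - Suc i"
      using xs A by (simp add: card_Diff_subset distinct_card)
    then have card: "card (A - set xs) \<ge> q + 1" using A(2) \<open>i < l\<close> by simp
    show ?thesis
    proof (rule forces_star[OF card, of "hd xs"])
      show "{hd xs, y} \<in> U" if "y \<in> A - set xs" for y
        using xs(5)[of y "hd xs"] that hd by auto
    next
      fix Z y assume Z: "Z \<subseteq> A - set xs" "y \<in> Z"
      have "successively (\<lambda>u v. {u, v} \<in> insert {hd xs, y} C) (y # xs)"
        using xs(4) \<open>xs \<noteq> []\<close>
        by (auto simp: successively_Cons insert_commute elim: successively_mono)
      moreover have "{z, w} \<in> U - (\<lambda>y. {hd xs, y}) ` Z"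
        if "w \<in> A - set (y # xs)" "z \<in> insert y (A - set (y # xs))" "w \<noteq> z" for z w
        using that Z hd xs(5)[of w z] by (auto simp: doubleton_eq_iff)
      ultimately show "I (Suc i) (insert {hd xs, y} C) (U - (\<lambda>y. {hd xs, y}) ` Z)"
        unfolding I_def using Z xs(1-3) by (intro exI[of _ "y # xs"]) auto
    qed
  qed
  ultimately have "forces q l (I l) C U"
    by (rule forces_iterate)
  then show ?thesis
    by (rule forces_mono) (auto simp: I_def)
qed

text \<open>The tooth \<open>bs ! i\<close> is chosen before \<open>xs ! j\<close>, \<open>j > i\<close>, makes its offer, so the edges needed
  for closing cycles later are never touched.\<close>

lemma forces_comb:
  assumes xs: "distinct xs" "q < length xs" "set xs \<inter> B = {}"
    and B: "finite B" "card B \<ge> 2 * q + 1"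
    and U: "\<And>x b. x \<in> set xs \<Longrightarrow> b \<in> B \<Longrightarrow> {x, b} \<in> U"
  shows "forces q (Suc q) (\<lambda>C' U'. \<exists>bs. length bs = Suc q \<and> distinct bs \<and> set bs \<subseteq> B \<and>
           (\<forall>i\<le>q. {xs ! i, bs ! i} \<in> C') \<and>
           (\<forall>i\<le>q. \<forall>j<length xs. i < j \<longrightarrow> {xs ! j, bs ! i} \<in> U')) C U"
proof -
  define I where "I h C' U' \<longleftrightarrow> (\<exists>bs. length bs = h \<and> distinct bs \<and> set bs \<subseteq> B \<and>
           (\<forall>i<h. {xs ! i, bs ! i} \<in> C') \<and>
           (\<forall>i<h. \<forall>j<length xs. i < j \<longrightarrow> {xs ! j, bs ! i} \<in> U') \<and>
           (\<forall>j<length xs. h \<le> j \<longrightarrow> (\<forall>b\<in>B. {xs ! j, b} \<in> U')))" for h C' U'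
  have "I 0 C U" unfolding I_def using U by auto
  moreover have "forces q 1 (I (Suc h)) C U" if h: "h < Suc q" and "I h C U" for h C U
  proof -
    obtain bs where bs: "length bs = h" "distinct bs" "set bs \<subseteq> B"
      "\<And>i. i < h \<Longrightarrow> {xs ! i, bs ! i} \<in> C"
      "\<And>i j. i < h \<Longrightarrow> j < length xs \<Longrightarrow> i < j \<Longrightarrow> {xs ! j, bs ! i} \<in> U"
      "\<And>j b. j < length xs \<Longrightarrow> h \<le> j \<Longrightarrow> b \<in> B \<Longrightarrow> {xs ! j, b} \<in> U"
      using \<open>I h C U\<close> unfolding I_def by blast
    have "card (B - set bs) = card B - h"
      using bs B by (simp add: card_Diff_subset distinct_card)
    then have card: "card (B - set bs) \<ge> q + 1" using B(2) h by simp
    have hx: "h < length xs" using h xs by simp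
    show ?thesis
    proof (rule forces_star[OF card, of "xs ! h"])
      show "{xs ! h, y} \<in> U" if "y \<in> B - set bs" for y
        using bs(6) that hx by auto
    next
      fix Z b assume Z: "Z \<subseteq> B - set bs" "b \<in> Z"
      let ?C = "insert {xs ! h, b} C" and ?U = "U - (\<lambda>y. {xs ! h, y}) ` Z"
      \<comment> \<open>Round \<open>h\<close> touches only edges from \<open>xs ! h\<close> to
        \<open>Z\<close>. The alternative \<open>c \<notin> Z\<close> covers old teeth: for them
        \<open>j = h\<close> can occur, but they are excluded from \<open>Z\<close>.\<close>
      have neq: "{xs ! j, c} \<notin> (\<lambda>y. {xs ! h, y}) ` Z"
        if j: "j < length xs" and c: "c \<in> B" "j \<noteq> h \<or> c \<notin> Z" for j c
      proof
        assume "{xs ! j, c} \<in> (\<lambda>y. {xs ! h, y}) ` Z"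
        then obtain y where y: "y \<in> Z" "{xs ! j, c} = {xs ! h, y}" by auto
        have "xs ! j \<noteq> y" using j y(1) Z xs(3) by (meson DiffD1 disjoint_iff nth_mem subsetD)
        then have "xs ! j = xs ! h" "c = y" using y(2) by (auto simp: doubleton_eq_iff)
        then show False using j c(2) y(1) xs(1) hx by (auto simp: nth_eq_iff_index_eq)
      qed
      have "{xs ! j, (bs @ [b]) ! i} \<in> ?U" if "i < Suc h" "j < length xs" "i < j" for i j
      proof (cases "i = h")
        case True
        then show ?thesis using bs(1) bs(6)[of j b] Z neq[of j b] that by auto
      next
        case False
        then have i: "i < h" using that by simp
        then have "bs ! i \<in> set bs" using bs(1) by auto
        then have "bs ! i \<in> B" "bs ! i \<notin> Z" using bs(3) Z by auto
        then have "{xs ! j, bs ! i} \<in> ?U" using bs(5)[OF i] neq[of j "bs ! i"] that by simp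
        then show ?thesis using i bs(1) by (simp add: nth_append)
      qed
      moreover have "{xs ! j, c} \<in> ?U" if "j < length xs" "Suc h \<le> j" "c \<in> B" for j c
        using bs(6)[of j c] that Z neq[of j c] by auto
      moreover have "{xs ! i, (bs @ [b]) ! i} \<in> ?C" if "i < Suc h" for i
        using bs(1,4) that by (cases "i = h") (auto simp: nth_append)
      ultimately show "I (Suc h) ?C ?U"
        unfolding I_def using Z bs(1-3) by (intro exI[of _ "bs @ [b]"]) auto
    qed
  qed
  ultimately have "forces q (Suc q) (I (Suc q)) C U"
    by (rule forces_iterate)
  then show ?thesis
    by (rule forces_mono) (auto simp: I_def less_Suc_eq_le)
qed

lemma has_cycle_mono:
  assumes "has_cycle V E k" "V \<subseteq> V'" "E \<subseteq> E'"
  shows "has_cycle V' E' k"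
  using assms unfolding has_cycle_def by blast

text \<open>The tooth \<open>b\<close> closes up the \<open>t + 2\<close> path vertices with indices
  from \<open>i\<close> to \<open>i + t + 1\<close>. The shift by 3 makes \<open>t = 0\<close> a
  triangle.\<close>

lemma has_cycleI_path:
  assumes xs: "distinct xs" "set xs \<subseteq> V" "b \<in> V" "b \<notin> set xs" "i + Suc t < length xs"
    and path: "successively (\<lambda>u v. {u, v} \<in> E) xs"
    and b: "{xs ! i, b} \<in> E" "{xs ! (i + Suc t), b} \<in> E"
  shows "has_cycle V E (t + 3)"
proof -
  define ys where "ys = b # map (\<lambda>j. xs ! (i + j)) [0..<t + 2]"
  have len: "length ys = t + 3" by (simp add: ys_def)
  have ys: "ys ! Suc j = xs ! (i + j)" if "j < t + 2" for j
    using that unfolding ys_def by (simp del: upt_Suc)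
  have "distinct ys"
    using xs by (auto simp: ys_def distinct_map inj_on_def nth_eq_iff_index_eq simp del: upt_Suc)
  moreover have "set ys \<subseteq> V"
    using xs by (auto simp: ys_def simp del: upt_Suc)
  moreover have "{ys ! m, ys ! (Suc m mod (t + 3))} \<in> E" if m: "m < t + 3" for m
  proof (cases m)
    case 0
    then show ?thesis using b(1) ys[of 0] by (simp add: ys_def insert_commute)
  next
    case (Suc j)
    show ?thesis
    proof (cases "j = t + 1")
      case True
      then have "Suc m mod (t + 3) = 0" using Suc by (simp add: numeral_3_eq_3)
      moreover have "ys ! 0 = b" by (simp add: ys_def)
      ultimately show ?thesis using b(2) Suc True ys[of j] by simp
    next
      case False
      then have "j < t + 1" using m Suc by simp
      moreover have "{xs ! (i + j), xs ! Suc (i + j)} \<in> E"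
        using path xs(5) \<open>j < t + 1\<close> by (auto simp: successively_conv_nth)
      ultimately show ?thesis using Suc ys[of j] ys[of "Suc j"] by simp
    qed
  qed
  ultimately show ?thesis
    unfolding has_cycle_def using len by auto
qed

text \<open>Round \<open>t\<close> offers one chord for each of the \<open>q + 1\<close> teeth,
  always reaching \<open>t + 1\<close> places further along the path. Different rounds use different
  distances, so no chord is offered twice. The largest index reached is
  \<open>q + m\<close>.\<close>

lemma forces_close_cycles:
  assumes xs: "distinct xs" "q + m < length xs" "set xs \<subseteq> V"
    and bs: "length bs = Suc q" "distinct bs" "set bs \<subseteq> V" "set xs \<inter> set bs = {}"
    and path: "successively (\<lambda>u v. {u, v} \<in> C) xs"
    and teeth: "\<And>i. i \<le> q \<Longrightarrow> {xs ! i, bs ! i} \<in> C"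
    and U: "\<And>i j. i \<le> q \<Longrightarrow> j < length xs \<Longrightarrow> i < j \<Longrightarrow> {xs ! j, bs ! i} \<in> U"
  shows "forces q m (\<lambda>C' U'. \<forall>t<m. has_cycle V C' (t + 3)) C U"
proof -
  define I where "I t C' U' \<longleftrightarrow> C \<subseteq> C' \<and> (\<forall>s<t. has_cycle V C' (s + 3)) \<and>
    (\<forall>i\<le>q. \<forall>j<length xs. i + t < j \<longrightarrow> {xs ! j, bs ! i} \<in> U')" for t C' U'
  have disj: "xs ! j \<noteq> bs ! i" if "j < length xs" "i \<le> q" for i j
    using that bs(1,4) by (metis disjoint_iff le_imp_less_Suc nth_mem)
  have "I 0 C U" unfolding I_def using U by auto
  moreover have "forces q 1 (I (Suc t)) C' U'" if t: "t < m" and I: "I t C' U'" for t C' U'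
  proof -
    define e where "e i = {xs ! (i + Suc t), bs ! i}" for i
    \<comment> \<open>A chord determines its tooth and its distance. This gives both that the
      \<open>q + 1\<close> chords are distinct and that those of later rounds remain
      unclaimed.\<close>
    have e_eq: "i = i' \<and> j = i' + Suc t" if "{xs ! j, bs ! i} = e i'" "i \<le> q" "i' \<le> q" "j < length xs" for i j i'
    proof -
      have "bs ! i = bs ! i'" "xs ! j = xs ! (i' + Suc t)"
        using that disj[of j i'] disj[of "i' + Suc t" i] xs(2) t
        by (auto simp: e_def doubleton_eq_iff)
      then show ?thesis using that xs bs t by (auto simp: nth_eq_iff_index_eq)
    qed
    have "inj_on e {..q}"
      using e_eq xs(2) t by (auto simp: inj_on_def e_def)
    then have card: "card (e ` {..q}) = q + 1" by (simp add: card_image)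
    have "e ` {..q} \<subseteq> U'"
      using I xs(2) t by (auto simp: I_def e_def)
    moreover have "I (Suc t) (insert (e i) C') (U' - e ` {..q})" if "i \<le> q" for i
    proof -
      have C': "C \<subseteq> insert (e i) C'" using I by (auto simp: I_def)
      have "has_cycle V (insert (e i) C') (t + 3)"
      proof (rule has_cycleI_path)
        show "successively (\<lambda>u v. {u, v} \<in> insert (e i) C') xs"
          using path C' by (auto elim!: successively_mono)
        show "{xs ! i, bs ! i} \<in> insert (e i) C'" using C' teeth[OF that] by auto
        show "bs ! i \<in> V" "bs ! i \<notin> set xs" using bs that by (auto simp: disjoint_iff)
      qed (use xs t that in \<open>auto simp: e_def\<close>)
      moreover have "has_cycle V (insert (e i) C') (s + 3)" if "s < t" for s
        using I that by (auto simp: I_def intro: has_cycle_mono)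
      moreover have "{xs ! j, bs ! k} \<notin> e ` {..q}" if "k \<le> q" "j < length xs" "k + Suc t < j" for k j
        using e_eq[of j k] that by auto
      ultimately show ?thesis
        using I C' by (auto simp: I_def less_Suc_eq)
    qed
    ultimately show ?thesis
      using card by (auto intro!: exI[of _ "e ` {..q}"])
  qed
  ultimately have "forces q m (I m) C U"
    by (rule forces_iterate)
  then show ?thesis
    by (rule forces_mono) (auto simp: I_def)
qed

text \<open>The round count splits into \<open>q + m\<close> for the path, \<open>Suc q\<close> for
  the teeth and \<open>m\<close> for the cycles. The path is built inside \<open>A\<close>, so the
  edges between \<open>A\<close> and \<open>B\<close> are still free when teeth are chosen. The path
  itself is kept in the conclusion as a target for the later stage.\<close>

lemma forces_cycles:
  assumes A: "finite A" "card A \<ge> 2 * q + m + 1" and B: "finite B" "card B \<ge> 2 * q + 1"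
    and disj: "A \<inter> B = {}" and U: "nsets (A \<union> B) 2 \<subseteq> U"
  shows "forces q (q + m + (Suc q + m)) (\<lambda>C' U'. (\<forall>t<m. has_cycle (A \<union> B) C' (t + 3)) \<and>
           (\<exists>xs. length xs = Suc (q + m) \<and> distinct xs \<and> set xs \<subseteq> A \<and>
                 successively (\<lambda>u v. {u, v} \<in> C') xs)) C U"
    (is "forces _ _ ?Q _ _")
proof -
  define R where "R = U - nsets A 2"
  define P where "P C' xs \<longleftrightarrow> length xs = Suc (q + m) \<and> distinct xs \<and> set xs \<subseteq> A \<and>
           successively (\<lambda>u v. {u, v} \<in> C') xs" for C' xs
  have "nsets A 2 \<union> R = U"
    using U nsets_mono[of A "A \<union> B" 2] by (auto simp: R_def)
  moreover have "forces q (q + m) (\<lambda>C' U'. \<exists>xs. P C' xs) C (nsets A 2)"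
    unfolding P_def by (rule forces_path) (use A in auto)
  then have "forces q (q + m) (\<lambda>C' V'. \<exists>U'. V' = U' \<union> R \<and> (\<exists>xs. P C' xs)) C (nsets A 2 \<union> R)"
    by (rule forces_frame) (auto simp: R_def)
  ultimately have "forces q (q + m) (\<lambda>C' V'. \<exists>U'. V' = U' \<union> R \<and> (\<exists>xs. P C' xs)) C U"
    by simp
  then show ?thesis
  proof (rule forces_trans)
    fix C V assume "\<exists>U'. V = U' \<union> R \<and> (\<exists>xs. P C xs)"
    then obtain xs where xs: "P C xs" and RV: "R \<subseteq> V" by auto
    have "{x, b} \<in> V" if "x \<in> set xs" "b \<in> B" for x b
    proof -
      have "x \<in> A" "x \<noteq> b" "b \<notin> A" using that xs disj by (auto simp: P_def)
      then have "{x, b} \<in> R" using U that by (auto simp: R_def nsets_def card_insert_if)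
      then show ?thesis using RV by auto
    qed
    then have "forces q (Suc q) (\<lambda>C' U'. \<exists>bs. length bs = Suc q \<and> distinct bs \<and> set bs \<subseteq> B \<and>
           (\<forall>i\<le>q. {xs ! i, bs ! i} \<in> C') \<and>
           (\<forall>i\<le>q. \<forall>j<length xs. i < j \<longrightarrow> {xs ! j, bs ! i} \<in> U')) C V"
      using xs disj B by (intro forces_comb) (auto simp: P_def)
    from forces_invariant[OF this] show "forces q (Suc q + m) ?Q C V"
    proof (rule forces_trans, elim conjE exE)
      fix C' U' bs
      assume bs: "length bs = Suc q" "distinct bs" "set bs \<subseteq> B" "\<forall>i\<le>q. {xs ! i, bs ! i} \<in> C'"
        "\<forall>i\<le>q. \<forall>j<length xs. i < j \<longrightarrow> {xs ! j, bs ! i} \<in> U'" "C \<subseteq> C'"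
      have xs': "P C' xs" using xs bs(6) by (auto simp: P_def elim!: successively_mono)
      then have "forces q m (\<lambda>C' U'. \<forall>t<m. has_cycle (A \<union> B) C' (t + 3)) C' U'"
        using bs disj by (intro forces_close_cycles[of xs _ _ _ bs]) (auto simp: P_def)
      from forces_invariant[OF this] show "forces q m ?Q C' U'"
        by (rule forces_mono) (use xs' in \<open>auto simp: P_def elim!: successively_mono\<close>)
    qed
  qed
qed

section \<open>Escaping from traps\<close>

text \<open>With at most \<open>q\<close> light elements there would be at least \<open>M\<close>
  elements heavier than \<open>B\<close>, and their total weight would exceed
  \<open>M * B\<close>.\<close>

lemma markov_card:
  fixes w :: "'a \<Rightarrow> real"
  assumes "finite Y" "\<And>y. y \<in> Y \<Longrightarrow> 0 \<le> w y" "M > 0"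
    and "real (card Y) \<ge> real q + M" "(\<Sum>y\<in>Y. w y) \<le> M * B"
  shows "card {y \<in> Y. w y \<le> B} \<ge> q + 1"
proof (rule ccontr)
  assume "\<not> ?thesis"
  then have good: "card {y \<in> Y. w y \<le> B} \<le> q" by simp
  define N where "N = {y \<in> Y. B < w y}"
  have "card Y = card {y \<in> Y. w y \<le> B} + card N"
    unfolding N_def using assms(1) by (subst card_Un_disjoint[symmetric]) (auto intro: arg_cong[where f = card])
  then have N: "real (card N) \<ge> M" using good assms(4) by simp
  then have "N \<noteq> {}" using assms(3) by auto
  have "finite N" using assms(1) by (simp add: N_def)
  have "(\<Sum>y\<in>Y. w y) \<ge> 0" using assms(2) by (rule sum_nonneg)
  then have "B \<ge> 0" using assms(3,5) by (smt (verit) zero_le_mult_iff)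
  then have "M * B \<le> card N * B" using N by (intro mult_right_mono)
  also have "\<dots> = (\<Sum>y\<in>N. B)" by simp
  also have "\<dots> < (\<Sum>y\<in>N. w y)"
    by (rule sum_strict_mono[OF \<open>finite N\<close> \<open>N \<noteq> {}\<close>]) (simp add: N_def)
  also have "\<dots> \<le> (\<Sum>y\<in>Y. w y)"
    using assms(1,2) by (intro sum_mono2) (auto simp: N_def)
  finally show False using assms(5) by simp
qed

text \<open>If each vertex \<open>v\<close> chose \<open>D\<close> random elements of \<open>T v\<close>, the hypothesis \<open>small\<close> would bound the
  expected number of pairs \<open>(S, A) \<in> F\<close> such that all choices of \<open>S\<close> lie in \<open>A\<close>. Waiter keeps
  the conditional expectation below \<open>1\<close> by offering only edges that do not increase it; by Markov's
  inequality there are more than \<open>q\<close> of them.\<close>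

lemma forces_escape:
  fixes T :: "'a \<Rightarrow> 'a set" and M :: real and F :: "('a set \<times> 'a set) set"
  assumes V: "finite V" and T: "\<And>v. v \<in> V \<Longrightarrow> finite (T v)"
    and owner: "\<And>v w y z. \<lbrakk>v \<in> V; w \<in> V; y \<in> T v; z \<in> T w; {v, y} = {w, z}\<rbrakk> \<Longrightarrow> v = w"
    and big: "\<And>v. v \<in> V \<Longrightarrow> real (card (T v)) \<ge> real (D * (q + 1) + q) + M"
    and M: "M > 0" and D: "D > 0"
    and U: "\<And>v y. v \<in> V \<Longrightarrow> y \<in> T v \<Longrightarrow> {v, y} \<in> U"
    and C: "\<And>v y. v \<in> V \<Longrightarrow> y \<in> T v \<Longrightarrow> {v, y} \<notin> C"
    and F: "finite F" "\<And>S A. (S, A) \<in> F \<Longrightarrow> S \<subseteq> V \<and> finite A"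
    and small: "(\<Sum>(S, A)\<in>F. (card A / M) ^ (D * card S)) < 1"
  shows "forces q (card V * D) (\<lambda>C' U'. (\<forall>v\<in>V. \<exists>y\<in>T v. {v, y} \<in> C') \<and>
           (\<forall>(S, A)\<in>F. \<exists>v\<in>S. \<exists>y\<in>T v - A. {v, y} \<in> C')) C U"
proof -
  define trapped where "trapped C' p \<longleftrightarrow> (\<forall>v\<in>fst p. \<forall>y\<in>T v. {v, y} \<in> C' \<longrightarrow> y \<in> snd p)"
    for C' :: "'a set set" and p :: "'a set \<times> 'a set"
  \<comment> \<open>\<open>a v\<close> counts the offers that \<open>v\<close> has left.
    \<open>wt a p\<close> plays the role of the probability that all remaining choices of
    \<open>fst p\<close> fall into \<open>snd p\<close>, each choice costing a factor
    \<open>card (snd p) / M\<close>.\<close>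
  define wt where "wt a p = (card (snd p) / M) ^ (\<Sum>v\<in>fst p. a v)"
    for a :: "'a \<Rightarrow> nat" and p :: "'a set \<times> 'a set"
  define \<Phi> where "\<Phi> C' a = (\<Sum>p \<in> {p \<in> F. trapped C' p}. wt a p)" for C' a
  \<comment> \<open>Each past offer of \<open>v\<close> has used up at most \<open>q + 1\<close> of
    its targets. The last conjunct records that \<open>v\<close> has an edge into \<open>T v\<close>
    after its first offer, as needed for connectivity.\<close>
  define I where "I t C' U' \<longleftrightarrow> (\<exists>a. (\<Sum>v\<in>V. a v) = card V * D - t \<and> \<Phi> C' a < 1 \<and>
      (\<forall>v\<in>V. a v \<le> D \<and> card (T v) \<le> card {y \<in> T v. {v, y} \<in> U'} + (D - a v) * (q + 1) \<and>
         (a v < D \<longrightarrow> (\<exists>y\<in>T v. {v, y} \<in> C'))))" for t C' U'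
  have wt0: "wt a p \<ge> 0" for a p using M by (simp add: wt_def)
  have "\<Phi> C (\<lambda>_. D) \<le> (\<Sum>p\<in>F. wt (\<lambda>_. D) p)"
    unfolding \<Phi>_def using F wt0 by (intro sum_mono2) auto
  also have "\<dots> = (\<Sum>(S, A)\<in>F. (card A / M) ^ (D * card S))"
    by (simp add: wt_def case_prod_unfold mult.commute)
  finally have "\<Phi> C (\<lambda>_. D) < 1" using small by simp
  moreover have "{y \<in> T v. {v, y} \<in> U} = T v" if "v \<in> V" for v using U that by auto
  ultimately have "I 0 C U" unfolding I_def by (intro exI[of _ "\<lambda>_. D"]) auto
  moreover have "forces q 1 (I (Suc t)) C U" if t: "t < card V * D" and "I t C U" for t C U
  proof -
    obtain a where a: "(\<Sum>v\<in>V. a v) = card V * D - t" "\<Phi> C a < 1" "\<And>v. v \<in> V \<Longrightarrow> a v \<le> D"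
        "\<And>v. v \<in> V \<Longrightarrow> card (T v) \<le> card {y \<in> T v. {v, y} \<in> U} + (D - a v) * (q + 1)"
        "\<And>v. v \<in> V \<Longrightarrow> a v < D \<Longrightarrow> \<exists>y\<in>T v. {v, y} \<in> C"
      using \<open>I t C U\<close> unfolding I_def by blast
    have "(\<Sum>v\<in>V. a v) \<noteq> 0" using a(1) t by simp
    then obtain v where v: "v \<in> V" "a v > 0" using V by auto
    define a' where "a' = a(v := a v - 1)"
    define Y where "Y = {y \<in> T v. {v, y} \<in> U}"
    define G where "G = {p \<in> F. trapped C p \<and> v \<in> fst p}"
    define H where "H = {p \<in> F. trapped C p \<and> v \<notin> fst p}"
    \<comment> \<open>The contribution, after Client takes \<open>{v, y}\<close>, of the pairs whose
      first component contains \<open>v\<close>. The contribution of \<open>H\<close> does not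
      change.\<close>
    define w where "w y = (\<Sum>p\<in>G. if y \<in> snd p then wt a' p else 0)" for y
    have fin: "finite Y" "finite G" "finite H"
      using T[OF v(1)] F(1) by (auto simp: Y_def G_def H_def)
    have fstF: "fst p \<subseteq> V" "finite (fst p)" "finite (snd p)" if "p \<in> F" for p
      using F(2)[of "fst p" "snd p"] that V by (auto intro: finite_subset)
    have \<Phi>C: "\<Phi> C a = (\<Sum>p\<in>G. wt a p) + (\<Sum>p\<in>H. wt a p)"
      unfolding \<Phi>_def by (subst sum.union_disjoint[symmetric, OF fin(2,3)])
        (auto simp: G_def H_def intro!: sum.cong)
    have wtH: "wt a' p = wt a p" if "p \<in> H" for p
      unfolding wt_def using that
      by (intro arg_cong2[where f = "(^)"] refl sum.cong) (auto simp: a'_def H_def)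
    \<comment> \<open>Spending one offer of \<open>v\<close> removes one factor
      \<open>card (snd p) / M\<close>.\<close>
    have wtG: "M * wt a p = card (snd p) * wt a' p" if "p \<in> G" for p
    proof -
      have p: "v \<in> fst p" "finite (fst p)" using that fstF by (auto simp: G_def)
      have "(\<Sum>u\<in>fst p. a u) = a v + (\<Sum>u\<in>fst p - {v}. a u)"
        "(\<Sum>u\<in>fst p. a' u) = a' v + (\<Sum>u\<in>fst p - {v}. a' u)"
        using p by (auto intro: sum.remove)
      moreover have "(\<Sum>u\<in>fst p - {v}. a' u) = (\<Sum>u\<in>fst p - {v}. a u)"
        by (intro sum.cong) (auto simp: a'_def)
      ultimately have "(\<Sum>u\<in>fst p. a u) = Suc (\<Sum>u\<in>fst p. a' u)"
        using v(2) by (simp add: a'_def)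
      then show ?thesis using M by (simp add: wt_def)
    qed
    have \<Phi>': "\<Phi> (insert {v, y} C) a' = w y + (\<Sum>p\<in>H. wt a p)" if "y \<in> T v" for y
    proof -
      have 1: "trapped (insert {v, y} C) p \<longleftrightarrow> trapped C p \<and> (v \<in> fst p \<longrightarrow> y \<in> snd p)"
        if "p \<in> F" for p
      proof -
        have "x \<in> snd p" if "trapped C p" "v \<in> fst p \<longrightarrow> y \<in> snd p" "u \<in> fst p" "x \<in> T u"
          "{u, x} \<in> insert {v, y} C" for u x
        proof (cases "{u, x} = {v, y}")
          case True
          then have "u = v"
            by (rule owner[rotated -1]) (use that \<open>y \<in> T v\<close> v(1) fstF(1)[OF \<open>p \<in> F\<close>] in auto)
          then have "x = y" using True by (auto simp: doubleton_eq_iff)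
          then show ?thesis using that \<open>u = v\<close> by simp
        next
          case False
          then show ?thesis using that unfolding trapped_def by blast
        qed
        moreover have "trapped C p \<and> (v \<in> fst p \<longrightarrow> y \<in> snd p)" if "trapped (insert {v, y} C) p"
          using that \<open>y \<in> T v\<close> unfolding trapped_def by blast
        ultimately show ?thesis unfolding trapped_def by blast
      qed
      have "\<Phi> (insert {v, y} C) a' = (\<Sum>p \<in> {p \<in> G. y \<in> snd p} \<union> H. wt a' p)"
        unfolding \<Phi>_def G_def H_def using 1 by (intro sum.cong) auto
      also have "\<dots> = (\<Sum>p \<in> {p \<in> G. y \<in> snd p}. wt a' p) + (\<Sum>p\<in>H. wt a' p)"
        by (rule sum.union_disjoint) (use fin in \<open>simp_all, auto simp: G_def H_def\<close>)
      also have "(\<Sum>p \<in> {p \<in> G. y \<in> snd p}. wt a' p) = w y"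
        unfolding w_def by (rule sum.inter_filter[OF fin(2)])
      also have "(\<Sum>p\<in>H. wt a' p) = (\<Sum>p\<in>H. wt a p)"
        using wtH by (rule sum.cong[OF refl])
      finally show ?thesis .
    qed
    \<comment> \<open>Double counting: a pair \<open>p\<close> survives for at most
      \<open>card (snd p)\<close> choices of \<open>y\<close>, which cancels exactly the factor lost
      from its weight.\<close>
    have "(\<Sum>y\<in>Y. w y) = (\<Sum>p\<in>G. \<Sum>y\<in>Y. if y \<in> snd p then wt a' p else 0)"
      unfolding w_def by (rule sum.swap)
    also have "\<dots> = (\<Sum>p\<in>G. card {y \<in> Y. y \<in> snd p} * wt a' p)"
      using fin(1) by (simp flip: sum.inter_filter)
    also have "\<dots> \<le> (\<Sum>p\<in>G. card (snd p) * wt a' p)"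
      using fstF wt0 by (intro sum_mono mult_right_mono of_nat_mono card_mono) (auto simp: G_def)
    also have "\<dots> = M * (\<Sum>p\<in>G. wt a p)"
      by (simp add: sum_distrib_left wtG)
    finally have wY: "(\<Sum>y\<in>Y. w y) \<le> M * (\<Sum>p\<in>G. wt a p)" .
    \<comment> \<open>At most \<open>D * (q + 1)\<close> targets of \<open>v\<close> are used up, so
      \<open>big\<close> leaves the \<open>q + M\<close> targets that Markov's inequality asks
      for.\<close>
    have "(D - a v) * (q + 1) \<le> D * (q + 1)" by (intro mult_right_mono) auto
    then have "card (T v) \<le> card Y + D * (q + 1)"
      using a(4)[OF v(1)] by (simp add: Y_def)
    then have "real (card Y) \<ge> real q + M"
      using big[OF v(1)] by linarith
    then have card: "card {y \<in> Y. w y \<le> (\<Sum>p\<in>G. wt a p)} \<ge> q + 1"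
      using fin(1) M wY wt0 by (intro markov_card) (auto simp: w_def intro!: sum_nonneg)
    show ?thesis
    proof (rule forces_star[OF card, of v])
      show "{v, y} \<in> U" if "y \<in> {y \<in> Y. w y \<le> (\<Sum>p\<in>G. wt a p)}" for y
        using that by (simp add: Y_def)
    next
      fix Z y assume Z: "Z \<subseteq> {y \<in> Y. w y \<le> (\<Sum>p\<in>G. wt a p)}" "card Z = q + 1" "y \<in> Z"
      let ?C = "insert {v, y} C" and ?U = "U - (\<lambda>y. {v, y}) ` Z"
      have y: "y \<in> T v" "w y \<le> (\<Sum>p\<in>G. wt a p)" using Z by (auto simp: Y_def)
      have "\<Phi> ?C a' < 1" using \<Phi>'[OF y(1)] y(2) \<Phi>C a(2) by simp
      moreover have "(\<Sum>u\<in>V. a' u) = card V * D - Suc t"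
      proof -
        have "(\<Sum>u\<in>V. a u) = a v + (\<Sum>u\<in>V - {v}. a u)"
          "(\<Sum>u\<in>V. a' u) = a' v + (\<Sum>u\<in>V - {v}. a' u)"
          using v V by (auto intro: sum.remove)
        moreover have "(\<Sum>u\<in>V - {v}. a' u) = (\<Sum>u\<in>V - {v}. a u)"
          by (intro sum.cong) (auto simp: a'_def)
        ultimately show ?thesis using v(2) a(1) by (simp add: a'_def)
      qed
      moreover have "card (T u) \<le> card {y \<in> T u. {u, y} \<in> ?U} + (D - a' u) * (q + 1)"
        if "u \<in> V" for u
      proof (cases "u = v")
        case True
        have "{y \<in> T v. {v, y} \<in> ?U} = Y - Z"
          by (auto simp: Y_def doubleton_eq_iff)
        moreover have "Z \<subseteq> Y" using Z by auto
        then have "card Y = card (Y - Z) + (q + 1)"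
          using Z(2) fin(1) by (metis card_Diff_subset card_mono finite_subset le_add_diff_inverse2)
        moreover have "D - a' v = Suc (D - a v)"
          using v a(3)[OF v(1)] by (simp add: a'_def)
        ultimately show ?thesis using a(4)[OF v(1)] True by (simp add: Y_def)
      next
        case False
        have "{y \<in> T u. {u, y} \<in> ?U} = {y \<in> T u. {u, y} \<in> U}"
        proof -
          have "{u, y} \<notin> (\<lambda>y. {v, y}) ` Z" if "y \<in> T u" for y
          proof
            assume "{u, y} \<in> (\<lambda>y. {v, y}) ` Z"
            then obtain z where "z \<in> T v" "{u, y} = {v, z}" using Z(1) by (auto simp: Y_def)
            then show False using owner[OF \<open>u \<in> V\<close> v(1) that] False by blast
          qed
          then show ?thesis by blast
        qed
        then show ?thesis using a(4)[OF that] False by (simp add: a'_def)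
      qed
      moreover have "\<exists>z\<in>T u. {u, z} \<in> ?C" if "u \<in> V" "a' u < D" for u
        using a(5)[OF that(1)] that(2) y(1) by (cases "u = v") (auto simp: a'_def)
      moreover have "a' u \<le> D" if "u \<in> V" for u
        using a(3)[OF that] a(3)[OF v(1)] by (auto simp: a'_def)
      ultimately show "I (Suc t) ?C ?U" unfolding I_def by blast
    qed
  qed
  ultimately have "forces q (card V * D) (I (card V * D)) C U"
    by (rule forces_iterate)
  then show ?thesis
  proof (rule forces_mono)
    fix C' U' assume "I (card V * D) C' U'"
    then obtain a where a: "(\<Sum>v\<in>V. a v) = 0" "\<Phi> C' a < 1"
        "\<And>v. v \<in> V \<Longrightarrow> a v < D \<Longrightarrow> \<exists>y\<in>T v. {v, y} \<in> C'"
      unfolding I_def by auto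
    have a0: "a v = 0" if "v \<in> V" for v using a(1) V that by simp
    \<comment> \<open>With no offers left the potential is the number of trapped pairs, and being
      below 1 it is 0.\<close>
    have "wt a p = 1" if "p \<in> F" for p
    proof -
      have "fst p \<subseteq> V" using F(2)[of "fst p" "snd p"] that by simp
      then have "(\<Sum>v\<in>fst p. a v) = 0" using a0 by (intro sum.neutral) auto
      then show ?thesis by (simp add: wt_def)
    qed
    then have "\<Phi> C' a = card {p \<in> F. trapped C' p}"
      by (simp add: \<Phi>_def)
    then have "{p \<in> F. trapped C' p} = {}" using a(2) F(1) by simp
    then have "\<not> trapped C' (S, A)" if "(S, A) \<in> F" for S A
      using that by blast
    then have "\<exists>v\<in>S. \<exists>y\<in>T v - A. {v, y} \<in> C'" if "(S, A) \<in> F" for S A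
      using that unfolding trapped_def fst_conv snd_conv by blast
    moreover have "\<exists>y\<in>T v. {v, y} \<in> C'" if "v \<in> V" for v
      using a(3)[OF that] a0[OF that] D by simp
    ultimately show "(\<forall>v\<in>V. \<exists>y\<in>T v. {v, y} \<in> C') \<and>
           (\<forall>(S, A)\<in>F. \<exists>v\<in>S. \<exists>y\<in>T v - A. {v, y} \<in> C')"
      by blast
  qed
qed

section \<open>Counting traps\<close>

text \<open>One term of the exponential series gives
  \<open>k ^ k / fact k \<le> exp k \<le> 3 ^ k\<close>. The product form also covers
  \<open>k = 0\<close>.\<close>

lemma binomial_mult_power_le: "real (n choose k) * real k ^ k \<le> (3 * real n) ^ k"
proof -
  have "(\<Sum>i\<in>{k}. inverse (fact i) *\<^sub>R real k ^ i) \<le> exp (real k)"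
    unfolding exp_def by (rule sum_le_suminf[OF summable_exp_generic]) auto
  also have "exp (real k) = exp 1 ^ k" by (simp flip: exp_of_nat_mult)
  also have "\<dots> \<le> 3 ^ k"
    using exp_bound[of 1] by (intro power_mono) auto
  finally have k: "real k ^ k \<le> 3 ^ k * fact k" by (simp add: field_simps)
  have "real ((n choose k) * fact k) \<le> real (n ^ k)"
    using binomial_fact_pow[of n k] by (simp only: of_nat_le_iff)
  then have n: "real (n choose k) * fact k \<le> real n ^ k" by simp
  have "real (n choose k) * real k ^ k \<le> real (n choose k) * (3 ^ k * fact k)"
    using k by (intro mult_left_mono) auto
  also have "\<dots> \<le> 3 ^ k * real n ^ k" using n by simp
  finally show ?thesis by (simp add: power_mult_distrib)
qed

text \<open>The binomial counts the sets \<open>A\<close> of size \<open>k\<close>, and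
  \<open>2 ^ k\<close> their subsets \<open>S\<close>. With
  \<open>y = 10 * k / n \<le> 1 / 4\<close>, the base of the \<open>k\<close>-th power is at most
  \<open>6 * (n / k) * y ^ 6 = 60 * y ^ 5 \<le> 60 / 1024\<close>.\<close>

lemma trap_count_le:
  assumes "0 < k" "40 * k \<le> n"
  shows "real (n choose k) * (2 ^ k * (10 * real k / real n) ^ (6 * k)) \<le> (1 / 4) ^ k"
proof -
  define y where "y = 10 * real k / real n"
  have n: "real n > 0" and k: "real k > 0" using assms by auto
  have y: "0 \<le> y" "y \<le> 1 / 4" using assms n by (auto simp: y_def field_simps)
  have "real (n choose k) = real (n choose k) * real k ^ k / real k ^ k" using k by simp
  also have "\<dots> \<le> (3 * real n) ^ k / real k ^ k"
    using binomial_mult_power_le by (intro divide_right_mono) auto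
  finally have "real (n choose k) \<le> (3 * real n / real k) ^ k" by (simp add: power_divide)
  then have "real (n choose k) * (2 ^ k * y ^ (6 * k)) \<le> (3 * real n / real k) ^ k * (2 ^ k * y ^ (6 * k))"
    using y by (intro mult_right_mono) auto
  also have "\<dots> = (3 * real n / real k * 2 * y ^ 6) ^ k"
    by (simp only: power_mult_distrib power_mult mult.assoc)
  also have "3 * real n / real k * 2 * y ^ 6 = 60 * y ^ 5"
    using n k by (simp add: y_def field_simps eval_nat_numeral)
  also have "(60 * y ^ 5) ^ k \<le> (1 / 4) ^ k"
  proof (rule power_mono)
    have "y ^ 5 \<le> (1 / 4) ^ 5" using y by (intro power_mono)
    then show "60 * y ^ 5 \<le> 1 / 4" by (simp add: eval_nat_numeral)
  qed (use y in auto)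
  finally show ?thesis by (simp add: y_def)
qed

text \<open>\<open>A\<close> stands for a superset of \<open>S\<close> and its neighbourhood:
  expansion by \<open>d / 2 - 1\<close> fails only if this union has size below \<open>d / 2\<close>
  times that of \<open>S\<close>. Denominators are cleared to stay in the naturals.\<close>

definition traps :: "'a set \<Rightarrow> nat \<Rightarrow> ('a set \<times> 'a set) set" where
  "traps V d = {(S, A). S \<subseteq> A \<and> A \<subseteq> V \<and> S \<noteq> {} \<and> 2 * card A \<le> d * card S \<and>
     20 * d * card S \<le> card V}"

lemma finite_traps: "finite V \<Longrightarrow> finite (traps V d)"
  by (rule finite_subset[of _ "Pow V \<times> Pow V"]) (auto simp: traps_def)

lemma sum_traps_less_1:
  assumes V: "finite V"
  shows "(\<Sum>(S, A)\<in>traps V d. (card A / (card V / 10)) ^ (3 * d * card S)) < 1"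
proof -
  define n where "n = card V"
  define \<A> where "\<A> = {A. A \<subseteq> V \<and> A \<noteq> {} \<and> 40 * card A \<le> n}"
  define g where "g k = (10 * real k / real n) ^ (6 * k)" for k
  have fin: "finite \<A>" using V by (simp add: \<A>_def)
  have finA: "finite A" if "A \<in> \<A>" for A
    using that V by (auto simp: \<A>_def intro: finite_subset)
  have finSigma: "finite (Sigma \<A> Pow)" using fin finA by auto
  have g0: "g k \<ge> 0" for k by (simp add: g_def)
  \<comment> \<open>Here \<open>A\<close> is chosen first and \<open>S\<close> inside it. The two
    size conditions combine to \<open>40 * card A \<le> 20 * d * card S \<le> n\<close>.\<close>
  have sub: "traps V d \<subseteq> prod.swap ` Sigma \<A> Pow"
    by (auto simp: traps_def \<A>_def n_def image_iff)
  have "(\<Sum>(S, A)\<in>traps V d. (card A / (card V / 10)) ^ (3 * d * card S))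
      \<le> (\<Sum>(S, A)\<in>traps V d. g (card A))"
  proof (intro sum_mono, clarify)
    fix S A assume "(S, A) \<in> traps V d"
    then have *: "2 * card A \<le> d * card S" "40 * card A \<le> n" "A \<noteq> {}" "A \<subseteq> V"
      by (auto simp: traps_def n_def)
    then have "card A > 0" using V by (meson card_gt_0_iff finite_subset)
    \<comment> \<open>As the base is at most 1, the exponent \<open>3 * d * card S\<close> may be
      lowered to \<open>6 * card A\<close>, which removes the dependence on
      \<open>S\<close>.\<close>
    then have "10 * real (card A) / real n \<le> 1" using * by (simp add: field_simps)
    then have "(10 * real (card A) / real n) ^ (3 * d * card S) \<le> g (card A)"
      unfolding g_def using * by (intro power_decreasing) auto
    then show "(card A / (card V / 10)) ^ (3 * d * card S) \<le> g (card A)"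
      by (simp add: n_def mult.commute)
  qed
  also have "\<dots> \<le> (\<Sum>(S, A)\<in>prod.swap ` Sigma \<A> Pow. g (card A))"
    using sub g0 finSigma by (intro sum_mono2) auto
  also have "\<dots> = (\<Sum>(A, S)\<in>Sigma \<A> Pow. g (card A))"
    by (subst sum.reindex) (auto simp: case_prod_unfold)
  also have "\<dots> = (\<Sum>A\<in>\<A>. \<Sum>S\<in>Pow A. g (card A))"
    using fin finA by (intro sum.Sigma[symmetric]) auto
  also have "\<dots> = (\<Sum>A\<in>\<A>. 2 ^ card A * g (card A))"
    using finA by (intro sum.cong) (auto simp: card_Pow)
  also have "\<dots> = (\<Sum>k\<in>{1..n}. \<Sum>A | A \<in> \<A> \<and> card A = k. 2 ^ card A * g (card A))"
  proof (rule sum.group[symmetric])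
    show "card ` \<A> \<subseteq> {1..n}"
    proof clarify
      fix A assume A: "A \<in> \<A>"
      then have "card A \<noteq> 0" using finA[OF A] by (simp add: \<A>_def)
      moreover have "40 * card A \<le> n" using A by (simp add: \<A>_def)
      ultimately show "card A \<in> {1..n}" by simp
    qed
  qed (use fin in auto)
  also have "\<dots> \<le> (\<Sum>k\<in>{1..n}. (1 / 4) ^ k)"
  proof (rule sum_mono)
    fix k assume k: "k \<in> {1..n}"
    show "(\<Sum>A | A \<in> \<A> \<and> card A = k. 2 ^ card A * g (card A)) \<le> (1 / 4) ^ k"
    proof (cases "40 * k \<le> n")
      case True
      have "card {A. A \<in> \<A> \<and> card A = k} \<le> card {A. A \<subseteq> V \<and> card A = k}"
        using V by (intro card_mono) (auto simp: \<A>_def)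
      then have "card {A. A \<in> \<A> \<and> card A = k} \<le> n choose k"
        using n_subsets[OF V] by (simp add: n_def)
      then have "(\<Sum>A | A \<in> \<A> \<and> card A = k. 2 ^ card A * g (card A)) \<le> real (n choose k) * (2 ^ k * g k)"
        using g0[of k] by (simp add: mult_right_mono)
      also have "\<dots> \<le> (1 / 4) ^ k"
        unfolding g_def using k True by (intro trap_count_le) auto
      finally show ?thesis .
    next
      case False
      then have empty: "{A. A \<in> \<A> \<and> card A = k} = {}" by (auto simp: \<A>_def)
      show ?thesis unfolding empty by simp
    qed
  qed
  also have "\<dots> < 1"
  proof -
    have geo: "(\<Sum>k\<in>{1..m}. x ^ k) = (1 - x ^ m) / 3" if x: "4 * x = 1" for m and x :: real
    proof (induction m)
      case 0
      then show ?case by simp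
    next
      case (Suc m)
      have "4 * x ^ Suc m = x ^ m" using x by (simp flip: mult.assoc)
      moreover have "(1 - a) / 3 + b = (1 - b) / 3" if "4 * b = a" for a b :: real
        using that by (simp add: field_simps)
      moreover have "(\<Sum>k\<in>{1..Suc m}. x ^ k) = (\<Sum>k\<in>{1..m}. x ^ k) + x ^ Suc m" by simp
      ultimately show ?case unfolding Suc.IH by metis
    qed
    have less: "(1 - y) / 3 < 1" if "y \<ge> 0" for y :: real
      using that by simp
    show ?thesis by (subst geo, simp, intro less zero_le_power, simp)
  qed
  finally show ?thesis .
qed

text \<open>A set \<open>S\<close> violating expansion forms a trap with
  \<open>S \<union> N\<close>. Escaping it would give a vertex of \<open>S\<close> a neighbour
  outside \<open>S\<close> and its neighbourhood \<open>N\<close>.\<close>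

lemma expander_if_escape:
  assumes V: "finite V" and T: "\<And>v. v \<in> V \<Longrightarrow> T v \<subseteq> V" and d: "d > 0"
    and escape: "\<And>S A. (S, A) \<in> traps V d \<Longrightarrow> \<exists>v\<in>S. \<exists>y\<in>T v - A. {v, y} \<in> E"
  shows "expander V E (real d / 2 - 1) (1 / (20 * real d))"
  unfolding expander_def
proof (intro allI impI)
  fix S assume S: "S \<subseteq> V" "real (card S) \<le> 1 / (20 * real d) * real (card V)"
  define N where "N = neighbourhood V E S"
  show "real (card (neighbourhood V E S)) \<ge> (real d / 2 - 1) * real (card S)"
  proof (rule ccontr)
    assume "\<not> ?thesis"
    then have less: "real (card N) < (real d / 2 - 1) * real (card S)" by (simp add: N_def)
    have fin: "finite S" "finite N" "S \<inter> N = {}"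
      using V S by (auto simp: N_def neighbourhood_def intro: finite_subset)
    have "S \<noteq> {}" using less by auto
    have "real (2 * card (S \<union> N)) \<le> real (d * card S)"
      using less fin by (simp add: card_Un_disjoint field_simps)
    then have "2 * card (S \<union> N) \<le> d * card S" by (simp only: of_nat_le_iff)
    moreover have "real (20 * d * card S) \<le> real (card V)"
      using S(2) d by (simp add: field_simps)
    then have "20 * d * card S \<le> card V" by (simp only: of_nat_le_iff)
    ultimately have "(S, S \<union> N) \<in> traps V d"
      using S(1) \<open>S \<noteq> {}\<close> by (auto simp: traps_def N_def neighbourhood_def)
    then obtain v y where "v \<in> S" "y \<in> T v" "y \<notin> S \<union> N" "{v, y} \<in> E"
      using escape by blast
    then show False using S(1) T[of v] by (auto simp: N_def neighbourhood_def)
  qed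
qed

section \<open>The three stages combined\<close>

definition edge_rel :: "'a set \<Rightarrow> 'a set set \<Rightarrow> ('a \<times> 'a) set" where
  "edge_rel V E = {(x, y). x \<in> V \<and> y \<in> V \<and> {x, y} \<in> E}"

lemma graph_connectedI:
  assumes "r \<in> V" "\<And>v. v \<in> V \<Longrightarrow> (v, r) \<in> (edge_rel V E)\<^sup>*"
  shows "graph_connected V E"
proof -
  have "sym (edge_rel V E)" by (auto simp: sym_def edge_rel_def insert_commute)
  then have "sym ((edge_rel V E)\<^sup>*)" by (rule sym_rtrancl)
  then have "(u, v) \<in> (edge_rel V E)\<^sup>*" if "u \<in> V" "v \<in> V" for u v
    using assms(2) that by (meson rtrancl_trans symD)
  then show ?thesis
    using assms(1) by (auto simp: graph_connected_def edge_rel_def)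
qed

lemma path_connected_to_hd:
  assumes "successively (\<lambda>u v. {u, v} \<in> E) xs" "set xs \<subseteq> V" "v \<in> set xs"
  shows "(v, hd xs) \<in> (edge_rel V E)\<^sup>*"
  using assms
proof (induction xs)
  case Nil
  then show ?case by simp
next
  case (Cons x xs)
  show ?case
  proof (cases "v = x")
    case True
    then show ?thesis by simp
  next
    case False
    then have v: "v \<in> set xs" using Cons.prems by simp
    then have ne: "xs \<noteq> []" by auto
    then have "(hd xs, x) \<in> edge_rel V E"
      using Cons.prems by (auto simp: successively_Cons edge_rel_def insert_commute)
    moreover have "(v, hd xs) \<in> (edge_rel V E)\<^sup>*"
      using Cons v ne by (auto simp: successively_Cons)
    ultimately show ?thesis by simp
  qed
qed

text \<open>The offers of a vertex in a later stage go to the next third of the vertices, so that no edge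
  can be offered by both of its ends; those of the last third go to the path \<open>xs\<close> in the first third.\<close>

definition targets :: "nat \<Rightarrow> nat list \<Rightarrow> nat \<Rightarrow> nat set" where
  "targets n xs v = (if v < n div 3 then {n div 3..<2 * (n div 3)}
     else if v < 2 * (n div 3) then {2 * (n div 3)..<n} else set xs)"

lemma targets_subset: "set xs \<subseteq> {..<n div 3} \<Longrightarrow> targets n xs v \<subseteq> {..<n}"
  by (auto simp: targets_def)

lemma targets_owner:
  assumes xs: "set xs \<subseteq> {..<n div 3}" and y: "y \<in> targets n xs v" "z \<in> targets n xs w"
    and eq: "{v, y} = {w, z}"
  shows "v = w"
proof (rule ccontr)
  assume "v \<noteq> w"
  then have "w = y" "z = v" using eq by (auto simp: doubleton_eq_iff)
  then show False using y xs by (auto simp: targets_def split: if_splits)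
qed

text \<open>Keeps the later offers disjoint from the first stage, which is played inside the first
  third.\<close>

lemma targets_not_in_first_third:
  assumes "set xs \<subseteq> {..<n div 3}" "y \<in> targets n xs v"
  shows "v \<noteq> y \<and> \<not> {v, y} \<subseteq> {..<n div 3}"
  using assms by (auto simp: targets_def split: if_splits)

text \<open>In the first two cases \<open>n div 3\<close> is positive, hence
  \<open>n \<le> 3 * (n div 3) + 2 \<le> 6 * (n div 3)\<close>; otherwise the path is the target
  set.\<close>

lemma card_targets:
  assumes "distinct xs" "n \<le> 6 * length xs"
  shows "n \<le> 6 * card (targets n xs v)"
  using assms by (auto simp: targets_def distinct_card)

text \<open>Following chosen targets leads from the first third to the second, then to the third,
  and from there onto the path.\<close>

lemma connected_if_targets:
  assumes xs: "xs \<noteq> []" "set xs \<subseteq> {..<n div 3}" "successively (\<lambda>u v. {u, v} \<in> E) xs"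
    and E: "\<And>v. v < n \<Longrightarrow> \<exists>y\<in>targets n xs v. {v, y} \<in> E"
  shows "graph_connected {..<n} E"
proof (rule graph_connectedI)
  have sub: "set xs \<subseteq> {..<n}" using xs(2) by auto
  have "hd xs \<in> set xs" using xs(1) by simp
  then show "hd xs \<in> {..<n}" using sub by auto
  let ?R = "edge_rel {..<n} E"
  have path: "(v, hd xs) \<in> ?R\<^sup>*" if "v \<in> set xs" for v
    using path_connected_to_hd[OF xs(3) sub that] .
  have step: "(v, hd xs) \<in> ?R\<^sup>*"
    if "v < n" "\<And>y. y \<in> targets n xs v \<Longrightarrow> (y, hd xs) \<in> ?R\<^sup>*" for v
  proof -
    obtain y where y: "y \<in> targets n xs v" "{v, y} \<in> E" using E[OF \<open>v < n\<close>] by blast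
    then have "(v, y) \<in> ?R" using targets_subset[OF xs(2)] \<open>v < n\<close> by (auto simp: edge_rel_def)
    then show ?thesis using that(2)[OF y(1)] by (rule converse_rtrancl_into_rtrancl)
  qed
  have third: "(v, hd xs) \<in> ?R\<^sup>*" if v: "v < n" "2 * (n div 3) \<le> v" for v
  proof (rule step)
    show "(y, hd xs) \<in> ?R\<^sup>*" if "y \<in> targets n xs v" for y
      by (rule path) (use that v in \<open>simp_all add: targets_def\<close>)
  qed (use v in simp)
  have second: "(v, hd xs) \<in> ?R\<^sup>*" if v: "v < 2 * (n div 3)" "n div 3 \<le> v" for v
  proof (rule step)
    show "(y, hd xs) \<in> ?R\<^sup>*" if "y \<in> targets n xs v" for y
      by (rule third) (use that v in \<open>simp_all add: targets_def\<close>)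
  qed (use v in simp)
  have first: "(v, hd xs) \<in> ?R\<^sup>*" if v: "v < n div 3" for v
  proof (rule step)
    show "(y, hd xs) \<in> ?R\<^sup>*" if "y \<in> targets n xs v" for y
      by (rule second) (use that v in \<open>simp_all add: targets_def\<close>)
  qed (use v in simp)
  show "(v, hd xs) \<in> ?R\<^sup>*" if "v \<in> {..<n}" for v
    using that first[of v] second[of v] third[of v] by (meson lessThan_iff not_le)
qed

theorem lemma4p11:
  fixes d :: nat
  assumes "d \<ge> 4"
  shows "\<exists>n0::nat. \<forall>n\<ge>n0. \<forall>q::nat. q \<ge> 1 \<and> real q \<le> real n / (1000 * real d) \<longrightarrow>
    waiter_can_ensure_within (nsets {..<n} 2) q (200 * n * d)
      (\<lambda>E. expander {..<n} E (real d / 2 - 1) (1 / (20 * real d)) \<and>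
           (\<forall>k::nat. 3 \<le> k \<and> int k \<le> \<lceil>real n / 6\<rceil> \<longrightarrow> has_cycle {..<n} E k) \<and>
           graph_connected {..<n} E)"
proof (intro exI[of _ "1000 * d"] allI impI, elim conjE)
  fix n q :: nat
  assume n: "1000 * d \<le> n" and q: "real q \<le> real n / (1000 * real d)"
  have "real (1000 * (d * q)) \<le> real n" using q assms by (simp add: field_simps)
  then have dq: "1000 * (d * q) \<le> n" by (simp only: of_nat_le_iff)
  have "4 * q \<le> d * q" using assms by simp
  then have q': "4000 * q \<le> n" using dq by linarith
  \<comment> \<open>The cycle lengths become \<open>3\<close> to \<open>c + 2\<close>, which covers
    the ceiling of \<open>n / 6\<close>, and the path gets \<open>q + c + 1 \<ge> n / 6\<close>
    vertices. \<open>a\<close> is the size that \<open>forces_cycles\<close> asks of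
    \<open>A\<close>.\<close>
  define c where "c = n div 6"
  define a where "a = 2 * q + c + 1"
  define A where "A = {..<a}"
  define B where "B = {a..<n div 3}"
  define P where "P E \<longleftrightarrow> expander {..<n} E (real d / 2 - 1) (1 / (20 * real d)) \<and>
           (\<forall>k::nat. 3 \<le> k \<and> int k \<le> \<lceil>real n / 6\<rceil> \<longrightarrow> has_cycle {..<n} E k) \<and>
           graph_connected {..<n} E" for E
  have room: "a + 2 * q + 1 \<le> n div 3"
    using q' n assms unfolding a_def c_def by linarith
  then have AB: "A \<union> B = {..<n div 3}" by (auto simp: A_def B_def)
  define X where "X = nsets {..<n div 3} 2"
  define R where "R = nsets {..<n} 2 - X"
  have XR: "X \<union> R = nsets {..<n} 2"
    unfolding R_def X_def using nsets_mono[of "{..<n div 3}" "{..<n}" 2] by auto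
  have "forces q (q + c + (Suc q + c)) (\<lambda>C U. (\<forall>t<c. has_cycle (A \<union> B) C (t + 3)) \<and>
           (\<exists>xs. length xs = Suc (q + c) \<and> distinct xs \<and> set xs \<subseteq> A \<and>
                 successively (\<lambda>u v. {u, v} \<in> C) xs)) {} X"
  proof (rule forces_cycles)
    show "2 * q + c + 1 \<le> card A" by (simp add: A_def a_def)
    show "2 * q + 1 \<le> card B" unfolding B_def using room by simp
    show "nsets (A \<union> B) 2 \<subseteq> X" unfolding AB X_def by simp
    show "finite A" "finite B" "A \<inter> B = {}" by (auto simp: A_def B_def)
  qed
  moreover have "X \<inter> R = {}" by (auto simp: R_def)
  ultimately have "forces q (q + c + (Suc q + c)) (\<lambda>C V. \<exists>U. V = U \<union> R \<and>
      ((\<forall>t<c. has_cycle (A \<union> B) C (t + 3)) \<and>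
           (\<exists>xs. length xs = Suc (q + c) \<and> distinct xs \<and> set xs \<subseteq> A \<and>
                 successively (\<lambda>u v. {u, v} \<in> C) xs)) \<and> {} \<subseteq> C \<and> C \<subseteq> {} \<union> X) {} (X \<union> R)"
    by (intro forces_frame forces_invariant)
  then have "forces q (q + c + (Suc q + c) + card {..<n} * (3 * d)) (\<lambda>C U. P C) {} (X \<union> R)"
  proof (rule forces_trans)
    fix C V
    assume "\<exists>U'. V = U' \<union> R \<and> ((\<forall>t<c. has_cycle (A \<union> B) C (t + 3)) \<and>
           (\<exists>xs. length xs = Suc (q + c) \<and> distinct xs \<and> set xs \<subseteq> A \<and>
                 successively (\<lambda>u v. {u, v} \<in> C) xs)) \<and> {} \<subseteq> C \<and> C \<subseteq> {} \<union> X"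
    then obtain xs where RV: "R \<subseteq> V" and CX: "C \<subseteq> X"
      and cyc: "\<And>t. t < c \<Longrightarrow> has_cycle (A \<union> B) C (t + 3)"
      and xs: "length xs = Suc (q + c)" "distinct xs" "set xs \<subseteq> A"
        "successively (\<lambda>u v. {u, v} \<in> C) xs"
      by blast
    have xs3: "set xs \<subseteq> {..<n div 3}" using xs(3) AB by auto
    define T where "T = targets n xs"
    \<comment> \<open>A target set has at least \<open>n / 6\<close> elements. The surplus
      \<open>n / 6 - n / 10 = n / 15\<close> absorbs \<open>3 * d * q\<close>, \<open>3 * d\<close>
      and \<open>q\<close>, each at most \<open>n / 60\<close>.\<close>
    have big: "real (card (T v)) \<ge> real (3 * d * (q + 1) + q) + real n / 10" for v
    proof -
      have "n \<le> 6 * length xs" unfolding xs(1) c_def by presburger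
      then have card: "n \<le> 6 * card (T v)"
        unfolding T_def by (rule card_targets[OF xs(2)])
      have "180 * (d * q) \<le> n" "180 * d \<le> n" "60 * q \<le> n"
        using dq q' n by linarith+
      then have "180 * (d * q) + 180 * d + 60 * q \<le> n + n + n" by (intro add_mono)
      then have "6 * (10 * (3 * (d * q) + 3 * d + q) + n) \<le> 10 * n" by simp
      also have "\<dots> \<le> 6 * (10 * card (T v))" using card by simp
      finally have "10 * (3 * (d * q) + 3 * d + q) + n \<le> 10 * card (T v)" by simp
      then have "10 * (3 * d * (q + 1) + q) + n \<le> 10 * card (T v)"
        by (simp add: algebra_simps)
      then have "real (10 * (3 * d * (q + 1) + q) + n) \<le> real (10 * card (T v))"
        by (simp only: of_nat_le_iff)
      then have "10 * real (3 * d * (q + 1) + q) + real n \<le> 10 * real (card (T v))"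
        by (simp only: of_nat_add of_nat_mult of_nat_numeral)
      moreover have "x + m / 10 \<le> y" if "10 * x + m \<le> 10 * y" for x m y :: real
        using that by simp
      ultimately show ?thesis by blast
    qed
    have free: "{v, y} \<in> R" "{v, y} \<notin> C" if "v \<in> {..<n}" "y \<in> T v" for v y
    proof -
      have "v \<noteq> y" "\<not> {v, y} \<subseteq> {..<n div 3}" "y < n"
        using that targets_not_in_first_third[OF xs3, of y v] targets_subset[OF xs3, of v]
        by (auto simp: T_def)
      then show "{v, y} \<in> R" "{v, y} \<notin> C"
        using that CX by (auto simp: R_def X_def nsets_def card_insert_if)
    qed
    have "forces q (card {..<n} * (3 * d)) (\<lambda>C' U'. (\<forall>v\<in>{..<n}. \<exists>y\<in>T v. {v, y} \<in> C') \<and>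
           (\<forall>(S, A)\<in>traps {..<n} d. \<exists>v\<in>S. \<exists>y\<in>T v - A. {v, y} \<in> C')) C V"
    \<comment> \<open>\<open>M = n / 10\<close> and \<open>3 * d\<close> offers per vertex give the
      weights summed in \<open>sum_traps_less_1\<close>.\<close>
    proof (rule forces_escape[where M = "real n / 10"])
      show "finite (T v)" for v by (simp add: T_def targets_def)
      show "v = w" if "y \<in> T v" "z \<in> T w" "{v, y} = {w, z}" for v w y z
        using targets_owner[OF xs3] that by (simp add: T_def)
      show "{v, y} \<in> V" if "v \<in> {..<n}" "y \<in> T v" for v y using free(1)[OF that] RV by auto
      show "finite (traps {..<n} d)" by (simp add: finite_traps)
      show "S \<subseteq> {..<n} \<and> finite A" if "(S, A) \<in> traps {..<n} d" for S A
        using that finite_subset[of A "{..<n}"] by (auto simp: traps_def)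
      show "(\<Sum>(S, A)\<in>traps {..<n} d. (card A / (real n / 10)) ^ (3 * d * card S)) < 1"
        using sum_traps_less_1[of "{..<n}" d] by simp
      show "real (card (T v)) \<ge> real (3 * d * (q + 1) + q) + real n / 10" for v
        by (rule big)
      show "{v, y} \<notin> C" if "v \<in> {..<n}" "y \<in> T v" for v y by (rule free(2)[OF that])
      show "0 < real n / 10" "0 < 3 * d" using n assms by simp_all
    qed simp
    from forces_invariant[OF this] show "forces q (card {..<n} * (3 * d)) (\<lambda>C U. P C) C V"
    proof (rule forces_mono, elim conjE)
      fix E U'
      assume E: "C \<subseteq> E" "\<forall>v\<in>{..<n}. \<exists>y\<in>T v. {v, y} \<in> E"
        "\<forall>(S, A)\<in>traps {..<n} d. \<exists>v\<in>S. \<exists>y\<in>T v - A. {v, y} \<in> E"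
      have "expander {..<n} E (real d / 2 - 1) (1 / (20 * real d))"
      proof (rule expander_if_escape[of _ T])
        show "T v \<subseteq> {..<n}" for v unfolding T_def by (rule targets_subset[OF xs3])
      qed (use E(3) assms in auto)
      moreover have "has_cycle {..<n} E k" if k: "3 \<le> k" "int k \<le> \<lceil>real n / 6\<rceil>" for k
      proof -
        have "real n / 6 \<le> real c + 1" unfolding c_def by linarith
        then have "\<lceil>real n / 6\<rceil> \<le> int c + 1" by linarith
        then have "k - 3 < c" using k by linarith
        from cyc[OF this] have "has_cycle (A \<union> B) C k" using k(1) by simp
        then show ?thesis by (rule has_cycle_mono) (use AB E(1) in auto)
      qed
      moreover have "successively (\<lambda>u v. {u, v} \<in> E) xs"
        using xs(4) E(1) by (auto elim!: successively_mono)
      then have "graph_connected {..<n} E"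
        using xs(1) xs3 E(2) by (intro connected_if_targets[of xs]) (auto simp: T_def)
      ultimately show "P E" by (simp add: P_def)
    qed
  qed
  moreover have "q + c + (Suc q + c) + card {..<n} * (3 * d) \<le> 200 * n * d"
  proof -
    obtain x where x: "n * d = x" by blast
    have "n * 4 \<le> n * d" using assms by (rule mult_le_mono2)
    then have "4 * n \<le> x" unfolding x by simp
    moreover have "card {..<n} * (3 * d) = 3 * x" "200 * n * d = 200 * x" by (simp_all flip: x)
    moreover have "c \<le> n" by (simp add: c_def)
    moreover have "n \<ge> 1" using n assms by simp
    ultimately show ?thesis using q' by linarith
  qed
  ultimately have "waiter_can_ensure_within (nsets {..<n} 2) q (200 * n * d) P"
    unfolding XR by (intro waiter_can_ensure_withinI finite_imp_finite_nsets finite_lessThan)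
  then show "waiter_can_ensure_within (nsets {..<n} 2) q (200 * n * d)
      (\<lambda>E. expander {..<n} E (real d / 2 - 1) (1 / (20 * real d)) \<and>
           (\<forall>k::nat. 3 \<le> k \<and> int k \<le> \<lceil>real n / 6\<rceil> \<longrightarrow> has_cycle {..<n} E k) \<and>
           graph_connected {..<n} E)"
    unfolding P_def .
qed

end
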